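(* Let $\mathcal{S}:\mathbb{S}^N\to\mathbb{S}^N$ be an invertible linear operator and let $\mathcal{M}$ be the positive definite metric on $\mathbb{S}^N$ with $\langle \cdot,\mathcal{M}\,\cdot\rangle=\langle \mathcal{S}\,\cdot,\mathcal{S}\,\cdot\rangle$. Suppose that for every symmetric matrix $\bm{Z}\in\mathbb{S}^N$, $$\mathcal{S}(\bm{Z})\in\mathbb{S}^N_+\iff \bm{Z}\in\mathbb{S}^N_+ .$$ Then, for every $\bm{V}\in\mathbb{S}^N$, $$\mathcal{S}^{-1}\circ\Pi_{\mathbb{S}^N_+}\circ\mathcal{S}\,(\bm{V})=\underset{\bm{Z}\in\mathbb{S}^N}{\mathrm{argmin}}\ \ \delta_{\mathbb{S}^N_+}(\bm{Z})+\frac12\Vert \bm{Z}-\bm{V}\Vert_{\mathcal{M}}^2 .$$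
   Context: $\mathbb{S}^N$ is the space of real symmetric $N\times N$ matrices with the Euclidean (trace/Frobenius) inner product $\langle\cdot,\cdot\rangle$ and induced norm $\Vert\cdot\Vert$; $\mathbb{S}^N_+=\{\bm{X}\in\mathbb{S}^N : \bm{X}\succeq 0\}$ is the positive semidefinite cone. $\delta_{\mathbb{S}^N_+}$ is the indicator function, equal to $0$ on $\mathbb{S}^N_+$ and $+\infty$ elsewhere. $\Pi_{\mathbb{S}^N_+}$ is the Euclidean projection onto $\mathbb{S}^N_+$ (i.e. setting all negative eigenvalues to zero). The metric norm is $\Vert \bm{V}\Vert_{\mathcal{M}}=\sqrt{\langle \bm{V},\mathcal{M}\bm{V}\rangle}$, and $\mathcal{M}=\mathcal{S}^*\mathcal{S}$. *)

theory Defs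
  imports "HOL-Analysis.Analysis" "HOL-Library.Extended_Real"
begin

(* The inner product of real ^ 'n ^ 'n is the entrywise one, i.e. the trace (Frobenius)
   inner product, and norm and dist are the ones induced by it. *)

definition sym_mats :: "(real ^ 'n ^ 'n) set" where
  "sym_mats = {X. transpose X = X}"

definition psd_cone :: "(real ^ 'n ^ 'n) set" where
  "psd_cone = {X \<in> sym_mats. \<forall>v. 0 \<le> v \<bullet> (X *v v)}"

(* Operators on a subspace V are represented by functions on the ambient type of which
   only the values on V matter. *)
definition linear_operator_on :: "'a::real_vector set \<Rightarrow> ('a \<Rightarrow> 'a) \<Rightarrow> bool" where
  "linear_operator_on V f \<longleftrightarrow>
     (\<forall>x\<in>V. f x \<in> V) \<and>
     (\<forall>x\<in>V. \<forall>y\<in>V. f (x + y) = f x + f y) \<and>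
     (\<forall>c. \<forall>x\<in>V. f (c *\<^sub>R x) = c *\<^sub>R f x)"

definition pos_def_metric_on :: "'a::real_inner set \<Rightarrow> ('a \<Rightarrow> 'a) \<Rightarrow> bool" where
  "pos_def_metric_on V M \<longleftrightarrow>
     linear_operator_on V M \<and>
     (\<forall>x\<in>V. \<forall>y\<in>V. x \<bullet> M y = M x \<bullet> y) \<and>
     (\<forall>x\<in>V. x \<noteq> 0 \<longrightarrow> 0 < x \<bullet> M x)"

definition metric_norm :: "('a::real_inner \<Rightarrow> 'a) \<Rightarrow> 'a \<Rightarrow> real" where
  "metric_norm M x = sqrt (x \<bullet> M x)"

definition convex_indicator :: "'a set \<Rightarrow> 'a \<Rightarrow> ereal" where
  "convex_indicator C x = (if x \<in> C then 0 else \<infinity>)"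

definition proj_psd :: "real ^ 'n ^ 'n \<Rightarrow> real ^ 'n ^ 'n" where
  "proj_psd X = closest_point psd_cone X"

(* The set of all minimizers, so that "x = argmin f", with its implicit uniqueness claim,
   reads argmin_set A f = {x}. *)
definition argmin_set :: "'a set \<Rightarrow> ('a \<Rightarrow> 'b::order) \<Rightarrow> 'a set" where
  "argmin_set A f = {x. is_arg_min f (\<lambda>y. y \<in> A) x}"

end

theory Submission imports Defs begin

text \<open>
  The identity \<open>\<langle>X, M Y\<rangle> = \<langle>S X, S Y\<rangle>\<close> turns the metric norm of \<open>Z - V\<close> into the Frobenius
  distance between \<open>S Z\<close> and \<open>S V\<close>, so \<open>S\<close> is an isometry from the metric of \<open>M\<close> to the
  Euclidean one (lemma \<open>metric_norm_diff_eq_dist\<close>). Since \<open>S\<close> is a bijection of the symmetric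
  matrices under which membership in the positive semidefinite cone is preserved in both
  directions, it maps the cone onto itself. Minimizing the objective over \<open>Z\<close> is thus
  minimizing the distance to \<open>S V\<close> over the points \<open>W = S Z\<close> of the cone. The cone is closed
  and convex, so \<open>W\<close> is the unique Euclidean projection of \<open>S V\<close>, and \<open>Z\<close> is its preimage.
\<close>

lemma subspace_sym_mats: "subspace (sym_mats :: (real ^ 'n ^ 'n) set)"
  by (auto simp: subspace_def sym_mats_def transpose_def vec_eq_iff)

lemma linear_quadratic_form: "linear (\<lambda>X :: real ^ 'n ^ 'n. v \<bullet> (X *v v))"
  by (rule linearI)
    (simp_all add: matrix_vector_mult_add_rdistrib inner_add_right scaleR_matrix_vector_assoc [symmetric])

text \<open>
  Each inequality \<open>0 \<le> v \<bullet> (X *v v)\<close> is linear in \<open>X\<close>, so the cone is the intersection of a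
  subspace with closed half-spaces; this yields both closedness and convexity.
\<close>

lemma psd_cone_eq_Inter:
  "psd_cone = sym_mats \<inter> (\<Inter>v. (\<lambda>X :: real ^ 'n ^ 'n. v \<bullet> (X *v v)) -` {0..})"
  by (auto simp: psd_cone_def)

lemma closed_psd_cone: "closed (psd_cone :: (real ^ 'n ^ 'n) set)"
proof -
  have "continuous_on UNIV (\<lambda>X :: real ^ 'n ^ 'n. v \<bullet> (X *v v))" for v
    by (intro linear_continuous_on linear_conv_bounded_linear[THEN iffD1] linear_quadratic_form)
  then show ?thesis
    unfolding psd_cone_eq_Inter
    by (intro closed_Int closed_subspace subspace_sym_mats closed_INT ballI
        closed_vimage closed_atLeast)
qed

lemma convex_psd_cone: "convex (psd_cone :: (real ^ 'n ^ 'n) set)"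
  unfolding psd_cone_eq_Inter
  by (intro convex_Int subspace_imp_convex subspace_sym_mats convex_INT
      convex_linear_vimage linear_quadratic_form convex_real_interval)

lemma zero_in_psd_cone: "0 \<in> psd_cone"
  using subspace_0[OF subspace_sym_mats] by (simp add: psd_cone_def)

lemma closest_point_characterization:
  fixes C :: "'a::euclidean_space set"
  assumes "closed C" "convex C" "C \<noteq> {}"
  shows "x = closest_point C a \<longleftrightarrow> x \<in> C \<and> (\<forall>y\<in>C. dist a x \<le> dist a y)"
  using assms closest_point_exists[of C a] closest_point_unique[of C x a] by blast

text \<open>
  An infinite indicator value excludes every point outside \<open>C\<close> as soon as \<open>C\<close> is nonempty, so
  minimizing the penalized objective over \<open>A\<close> is minimizing \<open>g\<close> over \<open>C\<close>.
\<close>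

lemma is_arg_min_convex_indicator:
  fixes g :: "'a \<Rightarrow> real"
  assumes "C \<subseteq> A" "C \<noteq> {}"
  shows "is_arg_min (\<lambda>z. convex_indicator C z + ereal (g z)) (\<lambda>z. z \<in> A) x
    \<longleftrightarrow> x \<in> C \<and> (\<forall>y\<in>C. g x \<le> g y)"
proof
  assume min: "is_arg_min (\<lambda>z. convex_indicator C z + ereal (g z)) (\<lambda>z. z \<in> A) x"
  have le: "convex_indicator C x + ereal (g x) \<le> ereal (g y)" if "y \<in> C" for y
  proof -
    have "\<not> convex_indicator C y + ereal (g y) < convex_indicator C x + ereal (g x)"
      using min that assms(1) unfolding is_arg_min_def by blast
    then show ?thesis
      using that by (simp add: convex_indicator_def not_less)
  qed
  obtain y where "y \<in> C"
    using assms(2) by blast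
  then have "x \<in> C"
    using le[of y] by (simp add: convex_indicator_def split: if_splits)
  then show "x \<in> C \<and> (\<forall>y\<in>C. g x \<le> g y)"
    using le by (simp add: convex_indicator_def)
next
  assume "x \<in> C \<and> (\<forall>y\<in>C. g x \<le> g y)"
  then show "is_arg_min (\<lambda>z. convex_indicator C z + ereal (g z)) (\<lambda>z. z \<in> A) x"
    using assms(1) by (auto simp: is_arg_min_def convex_indicator_def not_less)
qed

text \<open>
  On \<open>V\<close>, the form of \<open>M\<close> is the pullback of the Euclidean inner product along \<open>S\<close>, and linearity
  of \<open>S\<close> lets the pulled-back norm of a difference split into a distance of images.
\<close>

lemma metric_norm_diff_eq_dist:
  assumes V: "subspace V" and S: "linear_operator_on V S"
    and M: "\<And>x y. x \<in> V \<Longrightarrow> y \<in> V \<Longrightarrow> x \<bullet> M y = S x \<bullet> S y"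
    and x: "x \<in> V" and y: "y \<in> V"
  shows "metric_norm M (x - y) = dist (S y) (S x)"
proof -
  have "S (x - y) = S (x + (-1) *\<^sub>R y)" by simp
  also have "\<dots> = S x - S y"
    using S x y subspace_scale[OF V y, of "-1"]
    unfolding linear_operator_on_def by (metis scaleR_minus1_left diff_conv_add_uminus)
  finally show ?thesis
    using M[of "x - y" "x - y"] subspace_diff[OF V x y]
    by (simp add: metric_norm_def norm_eq_sqrt_inner[symmetric] dist_norm norm_minus_commute)
qed

theorem proposition3p1:
  fixes S M :: "real ^ 'n ^ 'n \<Rightarrow> real ^ 'n ^ 'n"
  assumes S_linear: "linear_operator_on sym_mats S"
    and S_invertible: "bij_betw S sym_mats sym_mats"
    and M_metric: "pos_def_metric_on sym_mats M"
    and M_S: "\<And>X Y. X \<in> sym_mats \<Longrightarrow> Y \<in> sym_mats \<Longrightarrow> X \<bullet> M Y = S X \<bullet> S Y"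
    and S_psd: "\<And>Z. Z \<in> sym_mats \<Longrightarrow> S Z \<in> psd_cone \<longleftrightarrow> Z \<in> psd_cone"
  shows "\<forall>V \<in> sym_mats.
    argmin_set sym_mats
      (\<lambda>Z. convex_indicator psd_cone Z + ereal (1 / 2 * (metric_norm M (Z - V))\<^sup>2))
    = {(inv_into sym_mats S \<circ> proj_psd \<circ> S) V}"
proof
  fix V :: "real ^ 'n ^ 'n"
  assume V: "V \<in> sym_mats"
  let ?F = "\<lambda>Z. convex_indicator psd_cone Z + ereal (1 / 2 * (metric_norm M (Z - V))\<^sup>2)"
  have psd_sym: "psd_cone \<subseteq> (sym_mats :: (real ^ 'n ^ 'n) set)"
    by (auto simp: psd_cone_def)
  have psd_nonempty: "psd_cone \<noteq> ({} :: (real ^ 'n ^ 'n) set)"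
    using zero_in_psd_cone by blast
  have image: "S ` psd_cone = psd_cone"
  proof
    show "S ` psd_cone \<subseteq> psd_cone"
      using S_psd psd_sym by blast
    show "psd_cone \<subseteq> S ` psd_cone"
    proof
      fix W :: "real ^ 'n ^ 'n"
      assume W: "W \<in> psd_cone"
      then obtain Z where "Z \<in> sym_mats" "W = S Z"
        using psd_sym bij_betw_imp_surj_on[OF S_invertible] by blast
      then show "W \<in> S ` psd_cone"
        using S_psd W by blast
    qed
  qed
  have dist: "metric_norm M (Z - V) = dist (S V) (S Z)" if "Z \<in> psd_cone" for Z
    by (rule metric_norm_diff_eq_dist[OF subspace_sym_mats S_linear M_S subsetD[OF psd_sym that] V])
  have proj_in: "proj_psd (S V) \<in> psd_cone"
    unfolding proj_psd_def by (rule closest_point_in_set[OF closed_psd_cone psd_nonempty])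
  have "is_arg_min ?F (\<lambda>Z. Z \<in> sym_mats) Z \<longleftrightarrow> Z = inv_into sym_mats S (proj_psd (S V))" for Z
  proof -
    have "is_arg_min ?F (\<lambda>Z. Z \<in> sym_mats) Z
        \<longleftrightarrow> Z \<in> psd_cone \<and> (\<forall>Y\<in>psd_cone. dist (S V) (S Z) \<le> dist (S V) (S Y))"
      unfolding is_arg_min_convex_indicator[OF psd_sym psd_nonempty]
      by (auto simp: dist abs_le_square_iff[symmetric])
    also have "\<dots> \<longleftrightarrow> Z \<in> psd_cone \<and> (\<forall>W\<in>S ` psd_cone. dist (S V) (S Z) \<le> dist (S V) W)"
      by simp
    also have "\<dots> \<longleftrightarrow> Z \<in> sym_mats \<and> S Z \<in> psd_cone \<and> (\<forall>W\<in>psd_cone. dist (S V) (S Z) \<le> dist (S V) W)"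
      unfolding image using S_psd psd_sym by blast
    also have "\<dots> \<longleftrightarrow> Z \<in> sym_mats \<and> S Z = proj_psd (S V)"
      unfolding proj_psd_def
      unfolding closest_point_characterization[OF closed_psd_cone convex_psd_cone psd_nonempty] ..
    also have "\<dots> \<longleftrightarrow> Z = inv_into sym_mats S (proj_psd (S V))"
    proof
      show "Z = inv_into sym_mats S (proj_psd (S V))"
        if "Z \<in> sym_mats \<and> S Z = proj_psd (S V)"
        using that bij_betw_inv_into_left[OF S_invertible, of Z] by simp
      show "Z \<in> sym_mats \<and> S Z = proj_psd (S V)"
        if "Z = inv_into sym_mats S (proj_psd (S V))"
        using that proj_in psd_sym bij_betw_inv_into_right[OF S_invertible]
          bij_betwE[OF bij_betw_inv_into[OF S_invertible]] by blast
    qed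
    finally show ?thesis .
  qed
  then show "argmin_set sym_mats ?F = {(inv_into sym_mats S \<circ> proj_psd \<circ> S) V}"
    by (auto simp: argmin_set_def)
qed

end
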